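(* Let $0<q<p<1$, and put $x=p/(1-p)$, $y=q/(1-q)$. For every integer $n\ge 0$, $$\frac{f(n+1)-f(n)}{((1-p)(1-q))^{n+1}}=\left(y+\tfrac12(1+xy)\right)\phi_n(xy)-\tfrac12\,\phi_{n+1}(xy),$$ where $$\phi_n(z)=\sum_{r=0}^n\binom{n}{r}^2z^r,\qquad\text{and}\qquad \phi_n(z)=(1-z)^nP_n\left(\frac{1+z}{1-z}\right)\quad(z\neq 1),$$ with $P_n$ the classical Legendre polynomial. Consequently the indicator function $$J_n(q,p)=\left(y+\tfrac12(1+xy)\right)\phi_n(xy)-\tfrac12\,\phi_{n+1}(xy)$$ has the same sign (positive, zero, or negative) as $f(n+1)-f(n)$.
   Context: For an integer $n\ge 0$ and $0<q<p<1$, $$f(n)=f(n,p,q)=\sum_{r\ge 0}\binom{n}{r}p^r(1-p)^{n-r}\sum_{s>r}\binom{n}{s}q^s(1-q)^{n-s},$$ the probability that, when Alice tosses a coin with heads probability $q$ and Bob a coin with heads probability $p$, each $n$ times independently, Alice gets strictly more heads than Bob. (So $f(0)=0$.) *)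

theory Defs
  imports Complex_Main "HOL-Computational_Algebra.Polynomial"
begin

text \<open>
  Alice's coin has heads probability \<open>q\<close>, Bob's has heads probability \<open>p\<close>; the outer index
  \<open>r\<close> counts Bob's heads and the inner index \<open>s\<close> counts Alice's. The sums are cut off
  at \<open>n\<close>, beyond which all binomial coefficients vanish.
\<close>

definition alice_wins :: "nat \<Rightarrow> real \<Rightarrow> real \<Rightarrow> real" where
  "alice_wins n p q =
     (\<Sum>r\<in>{0..n}. real (n choose r) * p ^ r * (1 - p) ^ (n - r) *
        (\<Sum>s\<in>{r<..n}. real (n choose s) * q ^ s * (1 - q) ^ (n - s)))"

definition phi :: "nat \<Rightarrow> real \<Rightarrow> real" where
  "phi n z = (\<Sum>r=0..n. (real (n choose r))\<^sup>2 * z ^ r)"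

text \<open>The Legendre polynomial in the classical normalisation, by Rodrigues' formula
  \<open>P\<^sub>n(t) = 1 / (2\<^sup>n n!) (d/dt)\<^sup>n (t\<^sup>2 - 1)\<^sup>n\<close>.\<close>

definition legendre_poly :: "nat \<Rightarrow> real poly" where
  "legendre_poly n = smult (1 / (2 ^ n * fact n)) ((pderiv ^^ n) ([:-1, 0, 1:] ^ n))"

text \<open>The arguments of \<open>J\<close> are in the order \<open>q\<close>, \<open>p\<close>, the reverse of that of
  \<^const>\<open>alice_wins\<close>.\<close>

definition J :: "nat \<Rightarrow> real \<Rightarrow> real \<Rightarrow> real" where
  "J n q p =
     (let x = p / (1 - p); y = q / (1 - q)
      in (y + 1/2 * (1 + x * y)) * phi n (x * y) - 1/2 * phi (n + 1) (x * y))"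

end

theory Submission imports Defs begin

text \<open>
  Dividing \<^term>\<open>alice_wins n p q\<close> by \<open>((1 - p) (1 - q))\<^sup>n\<close> leaves the sum
  \<open>A\<^sub>n\<close> of \<open>(n choose r) x\<^sup>r (n choose s) y\<^sup>s\<close> over all \<open>r < s\<close>. Since
  \<open>1 + x = 1 / (1 - p)\<close> and \<open>1 + y = 1 / (1 - q)\<close>, the normalised increment of the winning
  probability is \<open>A\<^bsub>n+1\<^esub> - (1 + x) (1 + y) A\<^sub>n\<close>. Pascal's rule in both indices amounts to
  tossing each coin once more after \<open>n\<close> rounds. The comparison \<open>r < s\<close> changes in two cases only:
  Alice draws ahead from a tie (weight \<open>y\<close>), or Bob catches up from one head behind (weight
  \<open>x\<close>). So the normalised increment equals \<open>y D - x E\<close>, where \<open>D\<close> and \<open>E\<close> are the sums over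
  the diagonal \<open>s = r\<close> and the off-diagonal \<open>s = r + 1\<close> (lemma \<open>pair_sum_less_Suc\<close>).

  The diagonal sum is \<open>D = \<phi>\<^sub>n(x y)\<close>. The off-diagonal sum is eliminated by the same
  extra toss, now applied to the tie condition: a tie after \<open>n + 1\<close> rounds comes from a tie in
  which both or neither get a head, or from either player being one behind and catching up. The
  last two contributions are equal, so \<open>\<phi>\<^bsub>n+1\<^esub>(x y) = (1 + x y) D + 2 x E\<close> (lemma \<open>phi_Suc\<close>).
  Solving for \<open>x E\<close> gives the formula for the increment, and the statement on signs holds because
  the normalising factor is positive.

  The Legendre formula is independent of this. Factor \<open>t\<^sup>2 - 1 = (t + 1) (t - 1)\<close> in
  Rodrigues' formula and differentiate by the Leibniz rule; the coefficients combine to squares of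
  binomial coefficients (lemma \<open>poly_legendre_poly\<close>). At \<open>t = (1 + z) / (1 - z)\<close> the two halves
  \<open>(t - 1) / 2\<close> and \<open>(t + 1) / 2\<close> are \<open>z / (1 - z)\<close> and \<open>1 / (1 - z)\<close>.
\<close>

text \<open>The weight \<open>g\<close> is arbitrary because Pascal's rule acts on it by shifting its arguments, so
  that one lemma serves the winning condition \<open>r < s\<close> and the tie condition \<open>s = r\<close>.\<close>
definition pair_sum :: "real \<Rightarrow> real \<Rightarrow> nat \<Rightarrow> (nat \<Rightarrow> nat \<Rightarrow> real) \<Rightarrow> real" where
  "pair_sum x y n g =
     (\<Sum>r\<le>n. \<Sum>s\<le>n. real (n choose r) * x ^ r * (real (n choose s) * y ^ s) * g r s)"

lemma pair_sum_cong:
  assumes "\<And>r s. g r s = h r s"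
  shows "pair_sum x y n g = pair_sum x y n h"
  by (simp add: pair_sum_def assms)

lemma pair_sum_linear:
  "pair_sum x y n (\<lambda>r s. a * g r s + b * h r s) = a * pair_sum x y n g + b * pair_sum x y n h"
  by (simp add: pair_sum_def sum_distrib_left sum.distrib[symmetric] algebra_simps)

text \<open>Pascal's rule, read as conditioning on the outcome of the last toss: it leaves \<open>r\<close>
  unchanged, or raises it by one at the price of a factor \<open>x\<close>. With \<open>x = 1\<close> the same rule drives
  the induction for the Leibniz formula, whence the general coefficient type.\<close>
lemma sum_binomial_Suc:
  fixes x :: "'a::comm_semiring_1"
  shows "(\<Sum>r\<le>Suc n. of_nat (Suc n choose r) * x ^ r * g r) =
         (\<Sum>r\<le>n. of_nat (n choose r) * x ^ r * (g r + x * g (Suc r)))"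
proof -
  have "(\<Sum>r\<le>Suc n. of_nat (Suc n choose r) * x ^ r * g r) =
        g 0 + (\<Sum>r\<le>n. of_nat (n choose Suc r) * x ^ Suc r * g (Suc r)) +
        (\<Sum>r\<le>n. of_nat (n choose r) * x ^ Suc r * g (Suc r))"
    by (subst sum.atMost_Suc_shift) (simp add: algebra_simps sum.distrib)
  also have "g 0 + (\<Sum>r\<le>n. of_nat (n choose Suc r) * x ^ Suc r * g (Suc r)) =
        (\<Sum>r\<le>Suc n. of_nat (n choose r) * x ^ r * g r)"
    by (subst sum.atMost_Suc_shift) simp
  also have "\<dots> = (\<Sum>r\<le>n. of_nat (n choose r) * x ^ r * g r)"
    by (simp add: binomial_eq_0)
  finally show ?thesis
    by (simp add: algebra_simps sum.distrib)
qed

lemma pair_sum_Suc: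
  "pair_sum x y (Suc n) g =
   pair_sum x y n (\<lambda>r s. g r s + x * g (Suc r) s + y * g r (Suc s) + x * y * g (Suc r) (Suc s))"
proof -
  have nested: "pair_sum x y m h =
      (\<Sum>r\<le>m. real (m choose r) * x ^ r * (\<Sum>s\<le>m. real (m choose s) * y ^ s * h r s))" for m h
    by (simp add: pair_sum_def sum_distrib_left mult.assoc)
  show ?thesis
    unfolding nested sum_binomial_Suc
    by (simp add: sum_distrib_left sum.distrib[symmetric] algebra_simps)
qed

lemma alice_wins_eq_pair_sum:
  assumes "p < 1" "q < 1"
  shows "alice_wins n p q =
    ((1 - p) * (1 - q)) ^ n * pair_sum (p / (1 - p)) (q / (1 - q)) n (\<lambda>r s. of_bool (r < s))"
proof -
  have weight: "a ^ r * (1 - a) ^ (n - r) = (1 - a) ^ n * (a / (1 - a)) ^ r"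
    if "r \<le> n" "a < 1" for r and a :: real
    using that by (simp add: power_diff power_divide)
  have inner: "(\<Sum>s\<in>{r<..n}. real (n choose s) * q ^ s * (1 - q) ^ (n - s)) =
      (\<Sum>s\<le>n. (1 - q) ^ n * (real (n choose s) * (q / (1 - q)) ^ s) * of_bool (r < s))" for r
    using assms
    by (intro sum.mono_neutral_cong_left) (auto simp: mult.assoc weight)
  have "alice_wins n p q = (\<Sum>r\<le>n. ((1 - p) ^ n * (real (n choose r) * (p / (1 - p)) ^ r)) *
      (\<Sum>s\<le>n. (1 - q) ^ n * (real (n choose s) * (q / (1 - q)) ^ s) * of_bool (r < s)))"
    unfolding alice_wins_def inner using assms
    by (intro sum.cong) (auto simp: mult.assoc weight)
  then show ?thesis
    by (simp add: pair_sum_def sum_distrib_left power_mult_distrib mult_ac)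
qed

lemma phi_eq_pair_sum:
  "phi n (x * y) = pair_sum x y n (\<lambda>r s. of_bool (s = r))"
  by (simp add: phi_def pair_sum_def of_bool_def if_distrib[of "\<lambda>u. _ * u"] sum.delta
      atLeast0AtMost power2_eq_square power_mult_distrib mult_ac cong: if_cong)

text \<open>Being one head behind and catching up has the same weight for both players: either way the
  term with heads counts \<open>k\<close> and \<open>k + 1\<close> is
  \<open>(n choose k) (n choose (k + 1)) (x y)\<^bsup>k+1\<^esup>\<close>.\<close>
lemma pair_sum_off_diagonal_symmetric:
  "y * pair_sum x y n (\<lambda>r s. of_bool (r = Suc s)) = x * pair_sum x y n (\<lambda>r s. of_bool (s = Suc r))"
proof -
  have "y * pair_sum x y n (\<lambda>r s. of_bool (r = Suc s)) =
      (\<Sum>s\<le>n. \<Sum>r\<le>n. y * (real (n choose r) * x ^ r * (real (n choose s) * y ^ s) * of_bool (r = Suc s)))"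
    unfolding pair_sum_def sum_distrib_left by (rule sum.swap)
  also have "\<dots> = x * pair_sum x y n (\<lambda>r s. of_bool (s = Suc r))"
    unfolding pair_sum_def sum_distrib_left
    by (intro sum.cong refl) (auto simp: of_bool_def)
  finally show ?thesis .
qed

text \<open>Solved for the off-diagonal sum, this removes it from the increment in favour of
  \<open>\<phi>\<^sub>n\<close> and \<open>\<phi>\<^bsub>n+1\<^esub>\<close>.\<close>
lemma phi_Suc:
  "phi (Suc n) (x * y) =
   (1 + x * y) * phi n (x * y) + 2 * x * pair_sum x y n (\<lambda>r s. of_bool (s = Suc r))"
proof -
  \<comment> \<open>The factor \<open>1\<close> brings the weight into the shape of \<open>pair_sum_linear\<close>.\<close>
  have "phi (Suc n) (x * y) = pair_sum x y n (\<lambda>r s. 1 *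
      ((1 + x * y) * of_bool (s = r) + x * of_bool (s = Suc r)) + y * of_bool (r = Suc s))"
    unfolding phi_eq_pair_sum pair_sum_Suc
    by (rule pair_sum_cong) (auto simp: algebra_simps)
  then show ?thesis
    unfolding pair_sum_linear phi_eq_pair_sum
    by (simp add: pair_sum_off_diagonal_symmetric)
qed

text \<open>After one more toss of each coin the weight of a pair \<open>(r, s)\<close> is
  \<open>(1 + x y) [r < s] + x [r + 1 < s] + y [r < s + 1]\<close>. Replacing both shifted comparisons by
  \<open>r < s\<close> gives the main term \<open>(1 + x) (1 + y) [r < s]\<close>, and the two errors are supported on
  \<open>s = r + 1\<close> and \<open>s = r\<close>.\<close>
lemma pair_sum_less_Suc:
  "pair_sum x y (Suc n) (\<lambda>r s. of_bool (r < s)) =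
   (1 + x) * (1 + y) * pair_sum x y n (\<lambda>r s. of_bool (r < s)) +
   (y * phi n (x * y) - x * pair_sum x y n (\<lambda>r s. of_bool (s = Suc r)))"
proof -
  have "pair_sum x y (Suc n) (\<lambda>r s. of_bool (r < s)) =
    pair_sum x y n (\<lambda>r s. (1 + x) * (1 + y) * of_bool (r < s) +
       1 * (y * of_bool (s = r) + (- x) * of_bool (s = Suc r)))"
    unfolding pair_sum_Suc
    by (rule pair_sum_cong) (auto simp: algebra_simps of_bool_def)
  then show ?thesis
    unfolding pair_sum_linear phi_eq_pair_sum by simp
qed

lemma alice_wins_increment:
  assumes "p < 1" "q < 1" and x: "x = p / (1 - p)" and y: "y = q / (1 - q)"
  shows "alice_wins (Suc n) p q - alice_wins n p q = ((1 - p) * (1 - q)) ^ Suc n *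
    ((y + 1/2 * (1 + x * y)) * phi n (x * y) - 1/2 * phi (Suc n) (x * y))"
proof -
  define S where "S = pair_sum x y n (\<lambda>r s. of_bool (r < s))"
  \<comment> \<open>This rescales the \<open>n\<close>-round probability to the normalisation of \<open>n + 1\<close> rounds.\<close>
  have "(1 - p) * (1 - q) * ((1 + x) * (1 + y)) = 1"
    using assms(1,2) unfolding x y by (simp add: divide_simps)
  then have "((1 - p) * (1 - q)) ^ n * S =
      ((1 - p) * (1 - q)) ^ n * ((1 - p) * (1 - q) * ((1 + x) * (1 + y))) * S"
    by simp
  then have old: "alice_wins n p q = ((1 - p) * (1 - q)) ^ Suc n * ((1 + x) * (1 + y) * S)"
    using assms(1,2) by (simp add: alice_wins_eq_pair_sum x y S_def mult_ac)
  have new: "alice_wins (Suc n) p q = ((1 - p) * (1 - q)) ^ Suc n *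
      ((1 + x) * (1 + y) * S + (y * phi n (x * y) - x * pair_sum x y n (\<lambda>r s. of_bool (s = Suc r))))"
    using assms(1,2) unfolding S_def pair_sum_less_Suc[symmetric]
    by (simp only: alice_wins_eq_pair_sum x y)
  have "(y + 1/2 * (1 + x * y)) * phi n (x * y) - 1/2 * phi (Suc n) (x * y) =
      y * phi n (x * y) - x * pair_sum x y n (\<lambda>r s. of_bool (s = Suc r))"
    unfolding phi_Suc by (simp add: field_simps)
  then show ?thesis
    unfolding old new by (simp only: ring_distribs)
qed

text \<open>The Leibniz rule. Differentiating one factor or the other is the last toss of Pascal's rule,
  so the induction step is \<open>sum_binomial_Suc\<close> with \<open>x = 1\<close>.\<close>
lemma higher_pderiv_mult:
  "(pderiv ^^ n) (f * g) =
   (\<Sum>k\<le>n. of_nat (n choose k) * ((pderiv ^^ k) f * (pderiv ^^ (n - k)) g))"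
proof (induction n)
  case (Suc n)
  have "(pderiv ^^ Suc n) (f * g) =
      (\<Sum>k\<le>n. of_nat (n choose k) * pderiv ((pderiv ^^ k) f * (pderiv ^^ (n - k)) g))"
    using higher_pderiv_sum[of 1 "\<lambda>k. of_nat (n choose k) * ((pderiv ^^ k) f * (pderiv ^^ (n - k)) g)" "{..n}"]
    by (simp add: Suc.IH pderiv_mult)
  also have "\<dots> = (\<Sum>k\<le>n. of_nat (n choose k) * 1 ^ k *
      ((pderiv ^^ k) f * (pderiv ^^ (Suc n - k)) g + 1 * ((pderiv ^^ Suc k) f * (pderiv ^^ (Suc n - Suc k)) g)))"
    by (intro sum.cong) (auto simp: pderiv_mult Suc_diff_le algebra_simps)
  also have "\<dots> = (\<Sum>k\<le>Suc n. of_nat (Suc n choose k) * 1 ^ k *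
      ((pderiv ^^ k) f * (pderiv ^^ (Suc n - k)) g))"
    by (rule sum_binomial_Suc[symmetric])
  finally show ?case by simp
qed simp

lemma higher_pderiv_linear_power:
  fixes a :: "'a::field_char_0"
  assumes "k \<le> n"
  shows "(pderiv ^^ k) ([:a, 1:] ^ n) = smult (fact n / fact (n - k)) ([:a, 1:] ^ (n - k))"
  using assms
proof (induction k)
  case (Suc k)
  then have "n - k = Suc (n - Suc k)" by simp
  moreover from this have "fact (n - k) = (of_nat (n - k) * fact (n - Suc k) :: 'a)"
    by (metis fact_Suc)
  ultimately show ?case
    using Suc by (simp add: pderiv_smult pderiv_power_Suc pderiv_pCons del: power_Suc of_nat_Suc)
qed simp

text \<open>In the Leibniz expansion of \<open>(t + 1)\<^sup>n (t - 1)\<^sup>n\<close> the derivatives contribute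
  \<open>n! / (n - k)!\<close> and \<open>n! / k!\<close>; after division by the \<open>n!\<close> of Rodrigues' formula their product
  is a second binomial coefficient. The factor \<open>t + 1\<close> is taken first because it is then the
  power of \<open>t - 1\<close>, hence later of \<open>z\<close>, that carries the exponent \<open>k\<close>.\<close>
lemma poly_legendre_poly:
  "poly (legendre_poly n) t = (\<Sum>k\<le>n. (real (n choose k))\<^sup>2 * ((t - 1) / 2) ^ k * ((t + 1) / 2) ^ (n - k))"
proof -
  have "[:-1, 0, 1:] ^ n = [:1, 1:] ^ n * ([:-1, 1:] ^ n :: real poly)"
    by (simp flip: power_mult_distrib)
  then have "poly (legendre_poly n) t = (\<Sum>k\<le>n. real (n choose k) *
      (fact n / fact (n - k) * (t + 1) ^ (n - k) * (fact n / fact k * (t - 1) ^ k))) / (2 ^ n * fact n)"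
    by (simp add: legendre_poly_def higher_pderiv_mult higher_pderiv_linear_power poly_sum
        algebra_simps)
  also have "\<dots> = (\<Sum>k\<le>n. (real (n choose k))\<^sup>2 * ((t - 1) / 2) ^ k * ((t + 1) / 2) ^ (n - k))"
    unfolding sum_divide_distrib
  proof (rule sum.cong)
    fix k assume "k \<in> {..n}"
    then have "real (n choose k) = fact n / (fact k * fact (n - k))" "(2::real) ^ n = 2 ^ k * 2 ^ (n - k)"
      by (simp_all add: binomial_fact flip: power_add)
    then show "real (n choose k) * (fact n / fact (n - k) * (t + 1) ^ (n - k) *
        (fact n / fact k * (t - 1) ^ k)) / (2 ^ n * fact n) =
        (real (n choose k))\<^sup>2 * ((t - 1) / 2) ^ k * ((t + 1) / 2) ^ (n - k)"
      by (simp add: power_divide power2_eq_square mult_ac)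
  qed simp
  finally show ?thesis .
qed

lemma phi_eq_legendre_poly:
  assumes "z \<noteq> 1"
  shows "phi n z = (1 - z) ^ n * poly (legendre_poly n) ((1 + z) / (1 - z))"
proof -
  have half: "((1 + z) / (1 - z) - 1) / 2 = z / (1 - z)" "((1 + z) / (1 - z) + 1) / 2 = 1 / (1 - z)"
    using assms by (simp_all add: field_simps)
  have "(1 - z) ^ n * ((real (n choose k))\<^sup>2 * (z / (1 - z)) ^ k * (1 / (1 - z)) ^ (n - k)) =
      (real (n choose k))\<^sup>2 * z ^ k" if "k \<le> n" for k
    using that assms by (simp add: power_divide power_diff)
  then show ?thesis
    unfolding poly_legendre_poly half phi_def sum_distrib_left
    by (intro sum.cong) (auto simp: atLeast0AtMost)
qed

theorem theorem1:
  fixes p q x y :: real and n :: nat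
  assumes "0 < q" and "q < p" and "p < 1"
    and "x = p / (1 - p)" and "y = q / (1 - q)"
  shows "(alice_wins (n + 1) p q - alice_wins n p q) / ((1 - p) * (1 - q)) ^ (n + 1)
           = (y + 1/2 * (1 + x * y)) * phi n (x * y) - 1/2 * phi (n + 1) (x * y)
         \<and> (\<forall>z::real. z \<noteq> 1 \<longrightarrow>
              phi n z = (1 - z) ^ n * poly (legendre_poly n) ((1 + z) / (1 - z)))
         \<and> sgn (J n q p) = sgn (alice_wins (n + 1) p q - alice_wins n p q)"
proof (intro conjI allI impI)
  let ?c = "((1 - p) * (1 - q)) ^ (n + 1)"
  have pos: "?c > 0"
    using assms by (intro zero_less_power mult_pos_pos) auto
  have J: "J n q p = (y + 1/2 * (1 + x * y)) * phi n (x * y) - 1/2 * phi (n + 1) (x * y)"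
    by (simp add: J_def Let_def assms(4,5))
  have increment: "alice_wins (n + 1) p q - alice_wins n p q = ?c * J n q p"
    using alice_wins_increment[OF _ _ assms(4,5), of n] assms(1-3) unfolding J by simp
  show "(alice_wins (n + 1) p q - alice_wins n p q) / ?c =
      (y + 1/2 * (1 + x * y)) * phi n (x * y) - 1/2 * phi (n + 1) (x * y)"
    using pos unfolding increment J by (subst nonzero_mult_div_cancel_left) auto
  show "sgn (J n q p) = sgn (alice_wins (n + 1) p q - alice_wins n p q)"
    using pos unfolding increment by (simp only: sgn_mult sgn_pos mult_1)
qed (rule phi_eq_legendre_poly)

end
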